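(* For every natural number $k\ge 1$ there exist constants $c>0$ and $N$, depending only on $k$, such that for every $n>N$ there exist a set $E$ of $n$ points in $\mathbb{R}^2$ and a $k$-tuple $(\alpha_1,\dots,\alpha_k)$ of nonzero real numbers for which the number of $k$-chains of type $(\alpha_1,\dots,\alpha_k)$ in $E$ consisting of pairwise distinct points is at least $$c\, n^{\lceil (k+1)/2\rceil}.$$
   Context: For a $k$-tuple $(\alpha_1,\dots,\alpha_k)$ of real numbers, a $k$-chain of type $(\alpha_1,\dots,\alpha_k)$ in a finite set $E$ is a $(k+1)$-tuple $(R_1,\dots,R_{k+1})\in E^{k+1}$ such that $R_j\cdot R_{j+1}=\alpha_j$ for all $j=1,\dots,k$, where $\cdot$ is the standard dot product. *)

theory Defs
  imports "HOL-Analysis.Analysis"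
begin

text \<open>Tuples are lists, so the indices start at \<open>0\<close>; \<open>k\<close> is the length of \<open>\<alpha>\<close>.\<close>

definition dot_chains :: "real list \<Rightarrow> (real ^ 2) set \<Rightarrow> (real ^ 2) list set" where
  "dot_chains \<alpha> E = {R. length R = length \<alpha> + 1 \<and> set R \<subseteq> E \<and>
     (\<forall>j < length \<alpha>. R ! j \<bullet> R ! (j + 1) = \<alpha> ! j)}"

end

theory Submission
  imports Defs
begin

text \<open>
  For a nonzero \<open>s\<close>, the points \<open>R\<close> with \<open>(s, 0) \<bullet> R = s\<close> form the line \<open>x = 1\<close>, whatever \<open>s\<close> is.
  So if every second point of a chain, starting with the second one, is a prescribed point of the
  \<open>x\<close>-axis, and the dot products are chosen accordingly, then all the other points can be chosen
  freely and independently on that one line. A chain of \<open>k + 1\<close> points has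
  \<open>\<lceil>(k + 1) / 2\<rceil>\<close> free positions.

  The set \<open>E\<close> consists of the \<open>\<lfloor>(k + 1) / 2\<rfloor>\<close> points needed on the axis and, for all the rest, of
  points of the line \<open>x = 1\<close> off the axis. Different injective fillings of the free positions give
  different chains of distinct points. Filled one after the other, each free position still has at
  least \<open>n - k\<close> choices. For \<open>n > 2 k\<close> this is at least \<open>n / 2\<close>, so that \<open>c = (1 / 2) ^ \<lceil>(k + 1) / 2\<rceil>\<close> works.
\<close>

definition pt :: "real \<Rightarrow> real \<Rightarrow> real ^ 2" where
  "pt x y = vector [x, y]"

lemma inner_pt [simp]: "pt a b \<bullet> pt c d = a * c + b * d"
  by (simp add: pt_def inner_vec_def sum_2)

lemma pt_eq_iff [simp]: "pt a b = pt c d \<longleftrightarrow> a = c \<and> b = d"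
  by (metis pt_def vector_2)

definition axis_points :: "nat \<Rightarrow> (real ^ 2) set" where
  "axis_points k = (\<lambda>i. pt (real (2 * i + 1)) 0) ` {..<(k + 1) div 2}"

definition line_points :: "nat \<Rightarrow> (real ^ 2) set" where
  "line_points m = (\<lambda>y. pt 1 (real y)) ` {1..m}"

text \<open>Positions are counted from \<open>0\<close>, so the free ones are the even ones. Position \<open>i\<close>, when odd,
  carries the axis point with abscissa \<open>i\<close>; this makes the axis points distinct.\<close>

definition alternating_chain :: "nat \<Rightarrow> nat list \<Rightarrow> (real ^ 2) list" where
  "alternating_chain k ys =
     map (\<lambda>i. if even i then pt 1 (real (ys ! (i div 2))) else pt (real i) 0) [0..<k + 1]"

text \<open>Each dot product in an alternating chain is the abscissa of the axis point involved,
  that is, the odd one of the two adjacent positions.\<close>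

definition alternating_type :: "nat \<Rightarrow> real list" where
  "alternating_type k = map (\<lambda>j. if even j then real (j + 1) else real j) [0..<k]"

lemma length_alternating_chain [simp]: "length (alternating_chain k ys) = k + 1"
  by (simp add: alternating_chain_def)

lemma nth_alternating_chain:
  assumes "i \<le> k"
  shows "alternating_chain k ys ! i =
    (if even i then pt 1 (real (ys ! (i div 2))) else pt (real i) 0)"
  using assms by (simp add: alternating_chain_def del: upt_Suc)

lemma length_alternating_type [simp]: "length (alternating_type k) = k"
  by (simp add: alternating_type_def)

lemma alternating_type_nonzero: "a \<in> set (alternating_type k) \<Longrightarrow> a \<noteq> 0"
  by (auto simp: alternating_type_def elim!: oddE)

lemma finite_axis_union_line: "finite (axis_points k \<union> line_points m)"
  by (simp add: axis_points_def line_points_def)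

lemma card_axis_union_line: "card (axis_points k \<union> line_points m) = (k + 1) div 2 + m"
proof -
  have "card (axis_points k) = (k + 1) div 2"
    unfolding axis_points_def by (subst card_image) (auto simp: inj_on_def)
  moreover have "card (line_points m) = m"
    unfolding line_points_def by (subst card_image) (auto simp: inj_on_def)
  moreover have "axis_points k \<inter> line_points m = {}"
    by (auto simp: axis_points_def line_points_def)
  ultimately show ?thesis
    by (simp add: card_Un_disjoint axis_points_def line_points_def)
qed

lemma alternating_chain_in_dot_chains:
  assumes len: "length ys = k div 2 + 1" and ys: "set ys \<subseteq> {1..m}"
  shows "alternating_chain k ys \<in> dot_chains (alternating_type k) (axis_points k \<union> line_points m)"
proof -
  have "alternating_chain k ys ! i \<in> axis_points k \<union> line_points m" if "i \<le> k" for i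
  proof (cases "even i")
    case True
    have "i div 2 < length ys"
      using that len by (simp add: div_le_mono less_Suc_eq_le)
    then have "ys ! (i div 2) \<in> {1..m}"
      using ys nth_mem by blast
    then show ?thesis
      using True that by (simp add: nth_alternating_chain line_points_def)
  next
    case False
    then obtain t where t: "i = 2 * t + 1"
      by (elim oddE)
    with that have "t < (k + 1) div 2"
      by simp
    then show ?thesis
      using t that by (auto simp: nth_alternating_chain axis_points_def)
  qed
  then have "set (alternating_chain k ys) \<subseteq> axis_points k \<union> line_points m"
    unfolding subset_iff in_set_conv_nth
    by (metis Suc_eq_plus1 length_alternating_chain less_Suc_eq_le)
  moreover have "alternating_chain k ys ! j \<bullet> alternating_chain k ys ! (j + 1) =
      alternating_type k ! j" if "j < k" for j
    using that by (simp add: nth_alternating_chain alternating_type_def)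
  ultimately show ?thesis
    by (simp add: dot_chains_def)
qed

lemma distinct_alternating_chain:
  assumes len: "length ys = k div 2 + 1" and "0 \<notin> set ys" and "distinct ys"
  shows "distinct (alternating_chain k ys)"
proof -
  have lt: "i div 2 < length ys" if "i \<le> k" for i
    using that len by (simp add: div_le_mono less_Suc_eq_le)
  have pos: "ys ! (i div 2) \<noteq> 0" if "i \<le> k" for i
    using lt[OF that] \<open>0 \<notin> set ys\<close> by (metis nth_mem)
  have "i = j" if "i \<le> k" "j \<le> k" "alternating_chain k ys ! i = alternating_chain k ys ! j" for i j
  proof (cases "even i \<and> even j")
    case True
    with that have "ys ! (i div 2) = ys ! (j div 2)"
      by (simp add: nth_alternating_chain)
    then have "i div 2 = j div 2"
      using lt that \<open>distinct ys\<close> by (simp add: nth_eq_iff_index_eq)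
    with True show ?thesis
      by (metis dvd_mult_div_cancel)
  next
    case False
    with that pos[OF that(1)] pos[OF that(2)] show ?thesis
      by (auto simp: nth_alternating_chain split: if_splits)
  qed
  then show ?thesis
    by (auto simp: distinct_conv_nth less_Suc_eq_le)
qed

lemma inj_on_alternating_chain: "inj_on (alternating_chain k) {ys. length ys = k div 2 + 1}"
proof (rule inj_onI, clarsimp)
  fix ys zs :: "nat list"
  assume len: "length ys = Suc (k div 2)" "length zs = Suc (k div 2)"
    and eq: "alternating_chain k ys = alternating_chain k zs"
  have "ys ! i = zs ! i" if "i \<le> k div 2" for i
  proof -
    have "2 * i \<le> k"
      using that by simp
    then show ?thesis
      using arg_cong[OF eq, of "\<lambda>R. R ! (2 * i)"] by (simp add: nth_alternating_chain)
  qed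
  with len show "ys = zs"
    by (intro nth_equalityI) (auto simp: less_Suc_eq_le)
qed

lemma power_le_card_distinct_lists:
  assumes "finite A" and "p \<le> card A"
  shows "(card A - p + 1) ^ p \<le> card {xs. length xs = p \<and> distinct xs \<and> set xs \<subseteq> A}"
proof -
  have "(card A - p + 1) ^ p = (\<Prod>i\<in>{card A - p + 1..card A}. card A - p + 1)"
    using assms by simp
  also have "\<dots> \<le> \<Prod>{card A - p + 1..card A}"
    by (intro prod_mono) auto
  also have "\<dots> = card {xs. length xs = p \<and> distinct xs \<and> set xs \<subseteq> A}"
    using assms by (simp add: card_lists_distinct_length_eq)
  finally show ?thesis .
qed

text \<open>The base \<open>n - k\<close> counts the line points, \<open>n - (k + 1) div 2\<close> in all, that are still
  unused when only the last of the \<open>k div 2 + 1\<close> free positions remains to be filled.\<close>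

lemma card_distinct_dot_chains_ge:
  assumes "k < n"
  defines "E \<equiv> axis_points k \<union> line_points (n - (k + 1) div 2)"
  shows "(n - k) ^ (k div 2 + 1) \<le> card {R \<in> dot_chains (alternating_type k) E. distinct R}"
proof -
  define p m where "p = k div 2 + 1" and "m = n - (k + 1) div 2"
  define Y where "Y = {ys. length ys = p \<and> distinct ys \<and> set ys \<subseteq> {1..m}}"
  have "(k + 1) div 2 + p = k + 1"
    unfolding p_def by presburger
  then have pm: "p \<le> m" "m - p + 1 = n - k"
    using \<open>k < n\<close> by (auto simp: m_def)
  have "(n - k) ^ p \<le> card Y"
    using power_le_card_distinct_lists[of "{1..m}" p] pm by (simp add: Y_def)
  also have "card Y = card (alternating_chain k ` Y)"
    by (intro card_image[symmetric] inj_on_subset[OF inj_on_alternating_chain])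
      (auto simp: Y_def p_def)
  also have "\<dots> \<le> card {R \<in> dot_chains (alternating_type k) E. distinct R}"
  proof (rule card_mono)
    have "finite E"
      unfolding E_def by (rule finite_axis_union_line)
    then have "finite {R. set R \<subseteq> E \<and> length R = k + 1}"
      by (rule finite_lists_length_eq)
    then show "finite {R \<in> dot_chains (alternating_type k) E. distinct R}"
      by (rule rev_finite_subset) (auto simp: dot_chains_def)
    show "alternating_chain k ` Y \<subseteq> {R \<in> dot_chains (alternating_type k) E. distinct R}"
      using alternating_chain_in_dot_chains distinct_alternating_chain
      by (fastforce simp: Y_def p_def m_def E_def)
  qed
  finally show ?thesis
    by (simp only: p_def)
qed

theorem proposition1p3:
  fixes k :: nat
  assumes "k \<ge> 1"
  shows "\<exists>c::real. \<exists>N::nat. c > 0 \<and>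
    (\<forall>n > N. \<exists>(E :: (real ^ 2) set) \<alpha> :: real list.
       finite E \<and> card E = n \<and> length \<alpha> = k \<and> (\<forall>a \<in> set \<alpha>. a \<noteq> 0) \<and>
       real (card {R \<in> dot_chains \<alpha> E. distinct R}) \<ge> c * real n ^ nat \<lceil>(real k + 1) / 2\<rceil>)"
proof -
  define p where "p = k div 2 + 1"
  have "\<lceil>(real k + 1) / 2\<rceil> = int p"
    unfolding p_def by (cases "even k") (auto elim!: evenE oddE simp: ceiling_eq_iff)
  then have exponent: "nat \<lceil>(real k + 1) / 2\<rceil> = p"
    by simp
  have "\<exists>(E :: (real ^ 2) set) \<alpha> :: real list.
       finite E \<and> card E = n \<and> length \<alpha> = k \<and> (\<forall>a \<in> set \<alpha>. a \<noteq> 0) \<and>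
       real (card {R \<in> dot_chains \<alpha> E. distinct R}) \<ge> (1 / 2) ^ p * real n ^ p"
    if n: "n > 2 * k" for n
  proof -
    define E where "E = axis_points k \<union> line_points (n - (k + 1) div 2)"
    have "finite E"
      unfolding E_def by (rule finite_axis_union_line)
    moreover have "card E = n"
      using n by (simp add: E_def card_axis_union_line)
    moreover have "(1 / 2) ^ p * real n ^ p \<le>
        real (card {R \<in> dot_chains (alternating_type k) E. distinct R})"
    proof -
      have "(1 / 2) ^ p * real n ^ p = (real n / 2) ^ p"
        by (simp add: power_divide)
      also have "\<dots> \<le> real (n - k) ^ p"
        using n by (intro power_mono) auto
      also have "\<dots> \<le> real (card {R \<in> dot_chains (alternating_type k) E. distinct R})"
        proof -
          have "(n - k) ^ p \<le> card {R \<in> dot_chains (alternating_type k) E. distinct R}"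
            using card_distinct_dot_chains_ge[of k n] n by (simp only: p_def E_def)
          then show ?thesis
            by (metis of_nat_le_iff of_nat_power)
        qed
      finally show ?thesis .
    qed
    ultimately show ?thesis
      using alternating_type_nonzero length_alternating_type by blast
  qed
  then show ?thesis
    unfolding exponent by (intro exI[of _ "(1 / 2) ^ p"] exI[of _ "2 * k"]) auto
qed

end
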